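(* Let $\mathcal C$ be an additive, symmetric, closed monoidal category and let $L$ be a Lie algebra in $\mathcal C$. Then there is an equivalence of categories between the category $\mathsf{LieMod}(L)$ of left Lie modules over $L$ and the category $\mathsf{Rep}(L)$ of representations of $L$.
   Context: Conventions: the tensor product is additive in each variable; associativity and unit constraints are suppressed; an object also denotes its identity morphism. The symmetry is denoted $c_{-,-}$. For an object $X$, $\mathsf H(X,-)$ is the right adjoint of $-\otimes X$, with adjunction isomorphism $\pi^X_{Y,Z}:\mathrm{Hom}(Y\otimes X,Z)\cong \mathrm{Hom}(Y,\mathsf H(X,Z))$ and counit $\epsilon^X_Y:\mathsf H(X,Y)\otimes X\to Y$. A Lie algebra in $\mathcal C$ is an object $L$ with a morphism $\Lambda:L\otimes L\to L$ such that, writing $\lambda=c_{L,L}$, $t=(\lambda\otimes L)\circ(L\otimes \lambda)$ and $w=(L\otimes\lambda)\circ(\lambda\otimes L)$, one has $\Lambda\circ(1_{L\otimes L}+\lambda)=0$ and $\Lambda\circ(L\otimes\Lambda)\circ(1_{L\otimes L\otimes L}+t+w)=0$. A morphism of Lie algebras $\phi:(L,\Lambda)\to(L',\Lambda')$ is a morphism with $\Lambda'\circ(\phi\otimes\phi)=\phi\circ\Lambda$. A left Lie module over $L$ is a pair $(X,\varrho_X)$ with $\varrho_X:L\otimes X\to X$ satisfying $\varrho_X\circ(L\otimes\varrho_X)-\varrho_X\circ(L\otimes\varrho_X)\circ(\lambda\otimes X)-\varrho_X\circ(\Lambda\otimes X)=0$. Morphisms of left Lie modules are morphisms $f:X\to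 Y$ with $f\circ\varrho_X=\varrho_Y\circ(L\otimes f)$. For an object $X$, put $m=\pi^X_{\mathsf H(X,X)\otimes \mathsf H(X,X),X}\big(\epsilon^X_X\circ(\mathsf H(X,X)\otimes\epsilon^X_X)\big):\mathsf H(X,X)\otimes\mathsf H(X,X)\to\mathsf H(X,X)$; $\mathsf H(X,X)$ is a Lie algebra with the commutator bracket $m-m\circ c_{\mathsf H(X,X),\mathsf H(X,X)}$. A representation of $L$ is a pair $(X,\phi_X)$ with $\phi_X:L\to\mathsf H(X,X)$ a morphism of Lie algebras. A morphism of representations $(X,\phi_X)\to(Y,\phi_Y)$ is a morphism $f:X\to Y$ in $\mathcal C$ with $f\circ\epsilon^X_X\circ(\phi_X\otimes X)=\epsilon^Y_Y\circ(\phi_Y\otimes Y)\circ(L\otimes f)$. *)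

theory Defs
  imports "HOL-Algebra.Group"
begin

section \<open>Categories, functors and equivalences\<close>

text \<open>
  Objects and arrows are the elements of sets inside arbitrary types. The operations are
  HOL functions, hence total; only their values on objects and composable arrows matter.
\<close>

record ('o, 'm) category =
  Obj :: "'o set"
  Arr :: "'m set"
  Dom :: "'m \<Rightarrow> 'o"
  Cod :: "'m \<Rightarrow> 'o"
  ident :: "'o \<Rightarrow> 'm"
  Comp :: "'m \<Rightarrow> 'm \<Rightarrow> 'm" (infixr "\<cdot>\<index>" 60)

definition Hom :: "('o, 'm, 'z) category_scheme \<Rightarrow> 'o \<Rightarrow> 'o \<Rightarrow> 'm set" where
  "Hom C X Y = {f \<in> Arr C. Dom C f = X \<and> Cod C f = Y}"

locale category =
  fixes C (structure)
  assumes Dom_Obj: "f \<in> Arr C \<Longrightarrow> Dom C f \<in> Obj C"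
    and Cod_Obj: "f \<in> Arr C \<Longrightarrow> Cod C f \<in> Obj C"
    and ident_Hom: "X \<in> Obj C \<Longrightarrow> ident C X \<in> Hom C X X"
    and Comp_Hom: "f \<in> Hom C X Y \<Longrightarrow> g \<in> Hom C Y Z \<Longrightarrow> g \<cdot> f \<in> Hom C X Z"
    and Comp_ident_right: "f \<in> Hom C X Y \<Longrightarrow> f \<cdot> ident C X = f"
    and Comp_ident_left: "f \<in> Hom C X Y \<Longrightarrow> ident C Y \<cdot> f = f"
    and Comp_assoc: "f \<in> Hom C X Y \<Longrightarrow> g \<in> Hom C Y Z \<Longrightarrow> h \<in> Hom C Z W \<Longrightarrow>
      (h \<cdot> g) \<cdot> f = h \<cdot> (g \<cdot> f)"

definition inverse_arrows :: "('o, 'm, 'z) category_scheme \<Rightarrow> 'm \<Rightarrow> 'm \<Rightarrow> bool" where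
  "inverse_arrows C f g \<longleftrightarrow>
     f \<in> Arr C \<and> g \<in> Hom C (Cod C f) (Dom C f) \<and>
     g \<cdot>\<^bsub>C\<^esub> f = ident C (Dom C f) \<and> f \<cdot>\<^bsub>C\<^esub> g = ident C (Cod C f)"

definition iso_arrow :: "('o, 'm, 'z) category_scheme \<Rightarrow> 'm \<Rightarrow> bool" where
  "iso_arrow C f \<longleftrightarrow> (\<exists>g. inverse_arrows C f g)"

definition inverse_arrow :: "('o, 'm, 'z) category_scheme \<Rightarrow> 'm \<Rightarrow> 'm" where
  "inverse_arrow C f = (THE g. inverse_arrows C f g)"

record ('o, 'm, 'p, 'n) functor_data =
  omap :: "'o \<Rightarrow> 'p"
  amap :: "'m \<Rightarrow> 'n"

locale covariant_functor = C: category C + D: category D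
  for C :: "('o, 'm, 'y) category_scheme"
    and D :: "('p, 'n, 'z) category_scheme"
    and F :: "('o, 'm, 'p, 'n) functor_data" +
  assumes omap_Obj: "X \<in> Obj C \<Longrightarrow> omap F X \<in> Obj D"
    and amap_Hom: "f \<in> Hom C X Y \<Longrightarrow> amap F f \<in> Hom D (omap F X) (omap F Y)"
    and amap_ident: "X \<in> Obj C \<Longrightarrow> amap F (ident C X) = ident D (omap F X)"
    and amap_Comp: "f \<in> Hom C X Y \<Longrightarrow> g \<in> Hom C Y Z \<Longrightarrow>
      amap F (g \<cdot>\<^bsub>C\<^esub> f) = amap F g \<cdot>\<^bsub>D\<^esub> amap F f"

definition identity_functor :: "('o, 'm, 'o, 'm) functor_data" where
  "identity_functor = \<lparr>omap = (\<lambda>X. X), amap = (\<lambda>f. f)\<rparr>"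

definition comp_functor ::
  "('p, 'n, 'q, 'k) functor_data \<Rightarrow> ('o, 'm, 'p, 'n) functor_data \<Rightarrow> ('o, 'm, 'q, 'k) functor_data"
  where "comp_functor G F = \<lparr>omap = omap G \<circ> omap F, amap = amap G \<circ> amap F\<rparr>"

locale natural_isomorphism = F: covariant_functor C D F + G: covariant_functor C D G
  for C :: "('o, 'm, 'y) category_scheme"
    and D :: "('p, 'n, 'z) category_scheme"
    and F G :: "('o, 'm, 'p, 'n) functor_data"
    and \<tau> :: "'o \<Rightarrow> 'n" +
  assumes component_Hom: "X \<in> Obj C \<Longrightarrow> \<tau> X \<in> Hom D (omap F X) (omap G X)"
    and component_iso: "X \<in> Obj C \<Longrightarrow> iso_arrow D (\<tau> X)"
    and naturality: "f \<in> Hom C X Y \<Longrightarrow> amap G f \<cdot>\<^bsub>D\<^esub> \<tau> X = \<tau> Y \<cdot>\<^bsub>D\<^esub> amap F f"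

definition equivalent_categories ::
  "('o, 'm, 'y) category_scheme \<Rightarrow> ('p, 'n, 'z) category_scheme \<Rightarrow> bool" where
  "equivalent_categories C D \<longleftrightarrow>
     category C \<and> category D \<and>
     (\<exists>(F :: ('o, 'm, 'p, 'n) functor_data) (G :: ('p, 'n, 'o, 'm) functor_data) \<eta> \<epsilon>.
        covariant_functor C D F \<and> covariant_functor D C G \<and>
        natural_isomorphism C C identity_functor (comp_functor G F) \<eta> \<and>
        natural_isomorphism D D (comp_functor F G) identity_functor \<epsilon>)"


section \<open>Additive categories\<close>

text \<open>
  Distinct hom-sets are disjoint, so a single addition of arrows serves all of them.
\<close>

record ('o, 'm) additive_category = "('o, 'm) category" +
  Add :: "'m \<Rightarrow> 'm \<Rightarrow> 'm" (infixl "\<oplus>\<index>" 55)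
  zero_arrow :: "'o \<Rightarrow> 'o \<Rightarrow> 'm"

definition hom_group :: "('o, 'm, 'z) additive_category_scheme \<Rightarrow> 'o \<Rightarrow> 'o \<Rightarrow> 'm monoid" where
  "hom_group C X Y = \<lparr>carrier = Hom C X Y, mult = Add C, one = zero_arrow C X Y\<rparr>"

definition Diff :: "('o, 'm, 'z) additive_category_scheme \<Rightarrow> 'm \<Rightarrow> 'm \<Rightarrow> 'm" (infixl "\<ominus>\<index>" 55)
  where "f \<ominus>\<^bsub>C\<^esub> g = f \<oplus>\<^bsub>C\<^esub> inv\<^bsub>hom_group C (Dom C g) (Cod C g)\<^esub> g"

locale preadditive_category = category C
  for C :: "('o, 'm, 'z) additive_category_scheme" (structure) +
  assumes hom_comm_group: "X \<in> Obj C \<Longrightarrow> Y \<in> Obj C \<Longrightarrow> comm_group (hom_group C X Y)"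
    and Comp_Add_left: "f \<in> Hom C X Y \<Longrightarrow> g \<in> Hom C Y Z \<Longrightarrow> g' \<in> Hom C Y Z \<Longrightarrow>
      (g \<oplus> g') \<cdot> f = g \<cdot> f \<oplus> g' \<cdot> f"
    and Comp_Add_right: "f \<in> Hom C X Y \<Longrightarrow> f' \<in> Hom C X Y \<Longrightarrow> g \<in> Hom C Y Z \<Longrightarrow>
      g \<cdot> (f \<oplus> f') = g \<cdot> f \<oplus> g \<cdot> f'"

definition zero_object :: "('o, 'm, 'z) category_scheme \<Rightarrow> 'o \<Rightarrow> bool" where
  "zero_object C Z \<longleftrightarrow>
     Z \<in> Obj C \<and> (\<forall>X\<in>Obj C. (\<exists>!f. f \<in> Hom C X Z) \<and> (\<exists>!f. f \<in> Hom C Z X))"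

definition biproduct ::
  "('o, 'm, 'z) additive_category_scheme \<Rightarrow> 'o \<Rightarrow> 'o \<Rightarrow> 'o \<Rightarrow> 'm \<Rightarrow> 'm \<Rightarrow> 'm \<Rightarrow> 'm \<Rightarrow> bool" where
  "biproduct C X Y P i\<^sub>1 i\<^sub>2 p\<^sub>1 p\<^sub>2 \<longleftrightarrow>
     P \<in> Obj C \<and>
     i\<^sub>1 \<in> Hom C X P \<and> i\<^sub>2 \<in> Hom C Y P \<and> p\<^sub>1 \<in> Hom C P X \<and> p\<^sub>2 \<in> Hom C P Y \<and>
     p\<^sub>1 \<cdot>\<^bsub>C\<^esub> i\<^sub>1 = ident C X \<and> p\<^sub>2 \<cdot>\<^bsub>C\<^esub> i\<^sub>2 = ident C Y \<and>
     p\<^sub>1 \<cdot>\<^bsub>C\<^esub> i\<^sub>2 = zero_arrow C Y X \<and> p\<^sub>2 \<cdot>\<^bsub>C\<^esub> i\<^sub>1 = zero_arrow C X Y \<and>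
     i\<^sub>1 \<cdot>\<^bsub>C\<^esub> p\<^sub>1 \<oplus>\<^bsub>C\<^esub> i\<^sub>2 \<cdot>\<^bsub>C\<^esub> p\<^sub>2 = ident C P"

locale additive_category = preadditive_category C
  for C :: "('o, 'm, 'z) additive_category_scheme" (structure) +
  assumes ex_zero_object: "\<exists>Z. zero_object C Z"
    and ex_biproduct: "X \<in> Obj C \<Longrightarrow> Y \<in> Obj C \<Longrightarrow>
      \<exists>P i\<^sub>1 i\<^sub>2 p\<^sub>1 p\<^sub>2. biproduct C X Y P i\<^sub>1 i\<^sub>2 p\<^sub>1 p\<^sub>2"


section \<open>Symmetric closed monoidal categories\<close>

text \<open>
  The records are extended linearly, so the structures below also carry the fields \<open>Add\<close> and
  \<open>zero_arrow\<close>; the locales for monoidal, symmetric and closed categories do not use them.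
  Monoidal categories are not assumed strict. The associator goes from \<open>(X \<otimes> Y) \<otimes> Z\<close> to
  \<open>X \<otimes> (Y \<otimes> Z)\<close>.
\<close>

record ('o, 'm) monoidal_category = "('o, 'm) additive_category" +
  tensor_obj :: "'o \<Rightarrow> 'o \<Rightarrow> 'o" (infixl "\<otimes>\<^sub>o\<index>" 70)
  tensor_arr :: "'m \<Rightarrow> 'm \<Rightarrow> 'm" (infixl "\<otimes>\<^sub>a\<index>" 70)
  unit_obj :: "'o"
  assoc :: "'o \<Rightarrow> 'o \<Rightarrow> 'o \<Rightarrow> 'm"
  lunit :: "'o \<Rightarrow> 'm"
  runit :: "'o \<Rightarrow> 'm"

locale monoidal_category = category C
  for C :: "('o, 'm, 'z) monoidal_category_scheme" (structure) +
  assumes tensor_Obj: "X \<in> Obj C \<Longrightarrow> Y \<in> Obj C \<Longrightarrow> X \<otimes>\<^sub>o Y \<in> Obj C"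
    and tensor_Hom: "f \<in> Hom C X X' \<Longrightarrow> g \<in> Hom C Y Y' \<Longrightarrow>
      f \<otimes>\<^sub>a g \<in> Hom C (X \<otimes>\<^sub>o Y) (X' \<otimes>\<^sub>o Y')"
    and tensor_ident: "X \<in> Obj C \<Longrightarrow> Y \<in> Obj C \<Longrightarrow>
      ident C X \<otimes>\<^sub>a ident C Y = ident C (X \<otimes>\<^sub>o Y)"
    and tensor_Comp: "f \<in> Hom C X X' \<Longrightarrow> f' \<in> Hom C X' X'' \<Longrightarrow>
      g \<in> Hom C Y Y' \<Longrightarrow> g' \<in> Hom C Y' Y'' \<Longrightarrow>
      (f' \<cdot> f) \<otimes>\<^sub>a (g' \<cdot> g) = (f' \<otimes>\<^sub>a g') \<cdot> (f \<otimes>\<^sub>a g)"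
    and unit_Obj: "unit_obj C \<in> Obj C"
    and assoc_Hom: "X \<in> Obj C \<Longrightarrow> Y \<in> Obj C \<Longrightarrow> Z \<in> Obj C \<Longrightarrow>
      assoc C X Y Z \<in> Hom C ((X \<otimes>\<^sub>o Y) \<otimes>\<^sub>o Z) (X \<otimes>\<^sub>o (Y \<otimes>\<^sub>o Z))"
    and assoc_iso: "X \<in> Obj C \<Longrightarrow> Y \<in> Obj C \<Longrightarrow> Z \<in> Obj C \<Longrightarrow> iso_arrow C (assoc C X Y Z)"
    and assoc_natural: "f \<in> Hom C X X' \<Longrightarrow> g \<in> Hom C Y Y' \<Longrightarrow> h \<in> Hom C Z Z' \<Longrightarrow>
      assoc C X' Y' Z' \<cdot> ((f \<otimes>\<^sub>a g) \<otimes>\<^sub>a h) = (f \<otimes>\<^sub>a (g \<otimes>\<^sub>a h)) \<cdot> assoc C X Y Z"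
    and lunit_Hom: "X \<in> Obj C \<Longrightarrow> lunit C X \<in> Hom C (unit_obj C \<otimes>\<^sub>o X) X"
    and lunit_iso: "X \<in> Obj C \<Longrightarrow> iso_arrow C (lunit C X)"
    and lunit_natural: "f \<in> Hom C X Y \<Longrightarrow>
      lunit C Y \<cdot> (ident C (unit_obj C) \<otimes>\<^sub>a f) = f \<cdot> lunit C X"
    and runit_Hom: "X \<in> Obj C \<Longrightarrow> runit C X \<in> Hom C (X \<otimes>\<^sub>o unit_obj C) X"
    and runit_iso: "X \<in> Obj C \<Longrightarrow> iso_arrow C (runit C X)"
    and runit_natural: "f \<in> Hom C X Y \<Longrightarrow>
      runit C Y \<cdot> (f \<otimes>\<^sub>a ident C (unit_obj C)) = f \<cdot> runit C X"
    and pentagon: "W \<in> Obj C \<Longrightarrow> X \<in> Obj C \<Longrightarrow> Y \<in> Obj C \<Longrightarrow> Z \<in> Obj C \<Longrightarrow>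
      (ident C W \<otimes>\<^sub>a assoc C X Y Z) \<cdot> assoc C W (X \<otimes>\<^sub>o Y) Z \<cdot> (assoc C W X Y \<otimes>\<^sub>a ident C Z)
      = assoc C W X (Y \<otimes>\<^sub>o Z) \<cdot> assoc C (W \<otimes>\<^sub>o X) Y Z"
    and triangle: "X \<in> Obj C \<Longrightarrow> Y \<in> Obj C \<Longrightarrow>
      (ident C X \<otimes>\<^sub>a lunit C Y) \<cdot> assoc C X (unit_obj C) Y = runit C X \<otimes>\<^sub>a ident C Y"

record ('o, 'm) symmetric_monoidal_category = "('o, 'm) monoidal_category" +
  symmetry :: "'o \<Rightarrow> 'o \<Rightarrow> 'm"

locale symmetric_monoidal_category = monoidal_category C
  for C :: "('o, 'm, 'z) symmetric_monoidal_category_scheme" (structure) +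
  assumes sym_Hom: "X \<in> Obj C \<Longrightarrow> Y \<in> Obj C \<Longrightarrow> symmetry C X Y \<in> Hom C (X \<otimes>\<^sub>o Y) (Y \<otimes>\<^sub>o X)"
    and sym_natural: "f \<in> Hom C X X' \<Longrightarrow> g \<in> Hom C Y Y' \<Longrightarrow>
      symmetry C X' Y' \<cdot> (f \<otimes>\<^sub>a g) = (g \<otimes>\<^sub>a f) \<cdot> symmetry C X Y"
    and sym_sym: "X \<in> Obj C \<Longrightarrow> Y \<in> Obj C \<Longrightarrow> symmetry C Y X \<cdot> symmetry C X Y = ident C (X \<otimes>\<^sub>o Y)"
    and hexagon: "X \<in> Obj C \<Longrightarrow> Y \<in> Obj C \<Longrightarrow> Z \<in> Obj C \<Longrightarrow>
      assoc C Y Z X \<cdot> symmetry C X (Y \<otimes>\<^sub>o Z) \<cdot> assoc C X Y Z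
      = (ident C Y \<otimes>\<^sub>a symmetry C X Z) \<cdot> assoc C Y X Z \<cdot> (symmetry C X Y \<otimes>\<^sub>a ident C Z)"

text \<open>
  \<open>ihom_obj C X\<close> and \<open>ihom_arr C X\<close> are the object and arrow parts of the functor \<open>H(X, -)\<close>;
  \<open>adj C X Y Z\<close> is the bijection from \<open>Hom(Y \<otimes> X, Z)\<close> to \<open>Hom(Y, H(X, Z))\<close>.
\<close>

record ('o, 'm) closed_monoidal_category = "('o, 'm) symmetric_monoidal_category" +
  ihom_obj :: "'o \<Rightarrow> 'o \<Rightarrow> 'o"
  ihom_arr :: "'o \<Rightarrow> 'm \<Rightarrow> 'm"
  adj :: "'o \<Rightarrow> 'o \<Rightarrow> 'o \<Rightarrow> 'm \<Rightarrow> 'm"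

locale symmetric_closed_monoidal_category = symmetric_monoidal_category C
  for C :: "('o, 'm, 'z) closed_monoidal_category_scheme" (structure) +
  assumes ihom_functor: "X \<in> Obj C \<Longrightarrow>
      covariant_functor C C \<lparr>omap = ihom_obj C X, amap = ihom_arr C X\<rparr>"
    and adj_bij: "X \<in> Obj C \<Longrightarrow> Y \<in> Obj C \<Longrightarrow> Z \<in> Obj C \<Longrightarrow>
      bij_betw (adj C X Y Z) (Hom C (Y \<otimes>\<^sub>o X) Z) (Hom C Y (ihom_obj C X Z))"
    and adj_natural: "X \<in> Obj C \<Longrightarrow> g \<in> Hom C Y' Y \<Longrightarrow> h \<in> Hom C Z Z' \<Longrightarrow>
      f \<in> Hom C (Y \<otimes>\<^sub>o X) Z \<Longrightarrow>
      adj C X Y' Z' (h \<cdot> f \<cdot> (g \<otimes>\<^sub>a ident C X)) = ihom_arr C X h \<cdot> adj C X Y Z f \<cdot> g"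

locale additive_symmetric_closed_monoidal_category =
  additive_category C + symmetric_closed_monoidal_category C
  for C :: "('o, 'm, 'z) closed_monoidal_category_scheme" (structure) +
  assumes tensor_Add_left: "f \<in> Hom C X X' \<Longrightarrow> f' \<in> Hom C X X' \<Longrightarrow> g \<in> Hom C Y Y' \<Longrightarrow>
      (f \<oplus> f') \<otimes>\<^sub>a g = f \<otimes>\<^sub>a g \<oplus> f' \<otimes>\<^sub>a g"
    and tensor_Add_right: "f \<in> Hom C X X' \<Longrightarrow> g \<in> Hom C Y Y' \<Longrightarrow> g' \<in> Hom C Y Y' \<Longrightarrow>
      f \<otimes>\<^sub>a (g \<oplus> g') = f \<otimes>\<^sub>a g \<oplus> f \<otimes>\<^sub>a g'"

definition counit :: "('o, 'm, 'z) closed_monoidal_category_scheme \<Rightarrow> 'o \<Rightarrow> 'o \<Rightarrow> 'm" where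
  "counit C X Y =
     inv_into (Hom C (ihom_obj C X Y \<otimes>\<^sub>o\<^bsub>C\<^esub> X) Y) (adj C X (ihom_obj C X Y) Y)
       (ident C (ihom_obj C X Y))"


section \<open>Lie algebras\<close>

text \<open>
  The permutations \<open>t\<close> and \<open>w\<close> of the three tensor factors, as endomorphisms of
  \<open>L \<otimes> (L \<otimes> L)\<close>, with the suppressed associators restored.
\<close>

definition lie_t :: "('o, 'm, 'z) symmetric_monoidal_category_scheme \<Rightarrow> 'o \<Rightarrow> 'm" where
  "lie_t C L =
     assoc C L L L \<cdot>\<^bsub>C\<^esub> (symmetry C L L \<otimes>\<^sub>a\<^bsub>C\<^esub> ident C L) \<cdot>\<^bsub>C\<^esub>
     inverse_arrow C (assoc C L L L) \<cdot>\<^bsub>C\<^esub> (ident C L \<otimes>\<^sub>a\<^bsub>C\<^esub> symmetry C L L)"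

definition lie_w :: "('o, 'm, 'z) symmetric_monoidal_category_scheme \<Rightarrow> 'o \<Rightarrow> 'm" where
  "lie_w C L =
     (ident C L \<otimes>\<^sub>a\<^bsub>C\<^esub> symmetry C L L) \<cdot>\<^bsub>C\<^esub> assoc C L L L \<cdot>\<^bsub>C\<^esub>
     (symmetry C L L \<otimes>\<^sub>a\<^bsub>C\<^esub> ident C L) \<cdot>\<^bsub>C\<^esub> inverse_arrow C (assoc C L L L)"

definition lie_algebra ::
  "('o, 'm, 'z) symmetric_monoidal_category_scheme \<Rightarrow> 'o \<Rightarrow> 'm \<Rightarrow> bool" where
  "lie_algebra C L \<Lambda> \<longleftrightarrow>
     L \<in> Obj C \<and> \<Lambda> \<in> Hom C (L \<otimes>\<^sub>o\<^bsub>C\<^esub> L) L \<and>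
     \<Lambda> \<cdot>\<^bsub>C\<^esub> (ident C (L \<otimes>\<^sub>o\<^bsub>C\<^esub> L) \<oplus>\<^bsub>C\<^esub> symmetry C L L) = zero_arrow C (L \<otimes>\<^sub>o\<^bsub>C\<^esub> L) L \<and>
     \<Lambda> \<cdot>\<^bsub>C\<^esub> (ident C L \<otimes>\<^sub>a\<^bsub>C\<^esub> \<Lambda>) \<cdot>\<^bsub>C\<^esub>
       (ident C (L \<otimes>\<^sub>o\<^bsub>C\<^esub> (L \<otimes>\<^sub>o\<^bsub>C\<^esub> L)) \<oplus>\<^bsub>C\<^esub> lie_t C L \<oplus>\<^bsub>C\<^esub> lie_w C L)
       = zero_arrow C (L \<otimes>\<^sub>o\<^bsub>C\<^esub> (L \<otimes>\<^sub>o\<^bsub>C\<^esub> L)) L"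

definition lie_morphism ::
  "('o, 'm, 'z) symmetric_monoidal_category_scheme \<Rightarrow> 'o \<Rightarrow> 'm \<Rightarrow> 'o \<Rightarrow> 'm \<Rightarrow> 'm \<Rightarrow> bool" where
  "lie_morphism C L \<Lambda> L' \<Lambda>' \<phi> \<longleftrightarrow>
     \<phi> \<in> Hom C L L' \<and> \<Lambda>' \<cdot>\<^bsub>C\<^esub> (\<phi> \<otimes>\<^sub>a\<^bsub>C\<^esub> \<phi>) = \<phi> \<cdot>\<^bsub>C\<^esub> \<Lambda>"


section \<open>Left Lie modules\<close>

definition lie_module ::
  "('o, 'm, 'z) symmetric_monoidal_category_scheme \<Rightarrow> 'o \<Rightarrow> 'm \<Rightarrow> 'o \<times> 'm \<Rightarrow> bool" where
  "lie_module C L \<Lambda> M \<longleftrightarrow> (case M of (X, \<rho>) \<Rightarrow>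
     X \<in> Obj C \<and> \<rho> \<in> Hom C (L \<otimes>\<^sub>o\<^bsub>C\<^esub> X) X \<and>
     \<rho> \<cdot>\<^bsub>C\<^esub> (ident C L \<otimes>\<^sub>a\<^bsub>C\<^esub> \<rho>) \<cdot>\<^bsub>C\<^esub> assoc C L L X
       \<ominus>\<^bsub>C\<^esub> \<rho> \<cdot>\<^bsub>C\<^esub> (ident C L \<otimes>\<^sub>a\<^bsub>C\<^esub> \<rho>) \<cdot>\<^bsub>C\<^esub> assoc C L L X \<cdot>\<^bsub>C\<^esub> (symmetry C L L \<otimes>\<^sub>a\<^bsub>C\<^esub> ident C X)
       \<ominus>\<^bsub>C\<^esub> \<rho> \<cdot>\<^bsub>C\<^esub> (\<Lambda> \<otimes>\<^sub>a\<^bsub>C\<^esub> ident C X)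
       = zero_arrow C ((L \<otimes>\<^sub>o\<^bsub>C\<^esub> L) \<otimes>\<^sub>o\<^bsub>C\<^esub> X) X)"

definition lie_module_morphism ::
  "('o, 'm, 'z) symmetric_monoidal_category_scheme \<Rightarrow> 'o \<Rightarrow> 'o \<times> 'm \<Rightarrow> 'o \<times> 'm \<Rightarrow> 'm \<Rightarrow> bool" where
  "lie_module_morphism C L M N f \<longleftrightarrow> (case (M, N) of ((X, \<rho>\<^sub>X), (Y, \<rho>\<^sub>Y)) \<Rightarrow>
     f \<in> Hom C X Y \<and> f \<cdot>\<^bsub>C\<^esub> \<rho>\<^sub>X = \<rho>\<^sub>Y \<cdot>\<^bsub>C\<^esub> (ident C L \<otimes>\<^sub>a\<^bsub>C\<^esub> f))"

text \<open>
  Arrows of \<open>LieMod\<close> and of \<open>Rep\<close> below are triples (source, underlying arrow of \<open>C\<close>, target).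
\<close>

definition LieMod ::
  "('o, 'm, 'z) symmetric_monoidal_category_scheme \<Rightarrow> 'o \<Rightarrow> 'm \<Rightarrow>
     ('o \<times> 'm, ('o \<times> 'm) \<times> 'm \<times> ('o \<times> 'm)) category" where
  "LieMod C L \<Lambda> = \<lparr>
     Obj = {M. lie_module C L \<Lambda> M},
     Arr = {(M, f, N). lie_module C L \<Lambda> M \<and> lie_module C L \<Lambda> N \<and> lie_module_morphism C L M N f},
     Dom = (\<lambda>(M, f, N). M),
     Cod = (\<lambda>(M, f, N). N),
     ident = (\<lambda>M. (M, ident C (fst M), M)),
     Comp = (\<lambda>(N', g, P) (M, f, N). (M, g \<cdot>\<^bsub>C\<^esub> f, P))\<rparr>"


section \<open>Representations\<close>

definition ihom_mult :: "('o, 'm, 'z) closed_monoidal_category_scheme \<Rightarrow> 'o \<Rightarrow> 'm" where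
  "ihom_mult C X = (let E = ihom_obj C X X in
     adj C X (E \<otimes>\<^sub>o\<^bsub>C\<^esub> E) X
       (counit C X X \<cdot>\<^bsub>C\<^esub> (ident C E \<otimes>\<^sub>a\<^bsub>C\<^esub> counit C X X) \<cdot>\<^bsub>C\<^esub> assoc C E E X))"

definition ihom_bracket :: "('o, 'm, 'z) closed_monoidal_category_scheme \<Rightarrow> 'o \<Rightarrow> 'm" where
  "ihom_bracket C X =
     ihom_mult C X \<ominus>\<^bsub>C\<^esub> ihom_mult C X \<cdot>\<^bsub>C\<^esub> symmetry C (ihom_obj C X X) (ihom_obj C X X)"

definition lie_representation ::
  "('o, 'm, 'z) closed_monoidal_category_scheme \<Rightarrow> 'o \<Rightarrow> 'm \<Rightarrow> 'o \<times> 'm \<Rightarrow> bool" where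
  "lie_representation C L \<Lambda> R \<longleftrightarrow> (case R of (X, \<phi>) \<Rightarrow>
     X \<in> Obj C \<and> lie_morphism C L \<Lambda> (ihom_obj C X X) (ihom_bracket C X) \<phi>)"

definition lie_representation_morphism ::
  "('o, 'm, 'z) closed_monoidal_category_scheme \<Rightarrow> 'o \<Rightarrow> 'o \<times> 'm \<Rightarrow> 'o \<times> 'm \<Rightarrow> 'm \<Rightarrow> bool" where
  "lie_representation_morphism C L R S f \<longleftrightarrow> (case (R, S) of ((X, \<phi>\<^sub>X), (Y, \<phi>\<^sub>Y)) \<Rightarrow>
     f \<in> Hom C X Y \<and>
     f \<cdot>\<^bsub>C\<^esub> counit C X X \<cdot>\<^bsub>C\<^esub> (\<phi>\<^sub>X \<otimes>\<^sub>a\<^bsub>C\<^esub> ident C X)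
       = counit C Y Y \<cdot>\<^bsub>C\<^esub> (\<phi>\<^sub>Y \<otimes>\<^sub>a\<^bsub>C\<^esub> ident C Y) \<cdot>\<^bsub>C\<^esub> (ident C L \<otimes>\<^sub>a\<^bsub>C\<^esub> f))"

definition Rep ::
  "('o, 'm, 'z) closed_monoidal_category_scheme \<Rightarrow> 'o \<Rightarrow> 'm \<Rightarrow>
     ('o \<times> 'm, ('o \<times> 'm) \<times> 'm \<times> ('o \<times> 'm)) category" where
  "Rep C L \<Lambda> = \<lparr>
     Obj = {R. lie_representation C L \<Lambda> R},
     Arr = {(R, f, S). lie_representation C L \<Lambda> R \<and> lie_representation C L \<Lambda> S \<and>
              lie_representation_morphism C L R S f},
     Dom = (\<lambda>(R, f, S). R),
     Cod = (\<lambda>(R, f, S). S),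
     ident = (\<lambda>R. (R, ident C (fst R), R)),
     Comp = (\<lambda>(S', g, T) (R, f, S). (R, g \<cdot>\<^bsub>C\<^esub> f, T))\<rparr>"

end

theory Submission
  imports Defs
begin

text \<open>
  Transposition along the adjunction \<open>- \<otimes> X \<stileturn> H(X, -)\<close> matches morphisms \<open>\<phi> : L \<rightarrow> H(X, X)\<close> with
  morphisms \<open>\<rho> = \<epsilon> \<cdot> (\<phi> \<otimes> X) : L \<otimes> X \<rightarrow> X\<close>. Since the transpose of \<open>m\<close> is the iterated evaluation,
  the transpose of \<open>m \<cdot> (\<phi> \<otimes> \<phi>)\<close> is \<open>\<rho> \<cdot> (L \<otimes> \<rho>)\<close>, and naturality of the symmetry handles the
  second term of the commutator; hence \<open>\<phi>\<close> preserves brackets exactly when \<open>\<rho>\<close> is a Lie action.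
  The two notions of morphism coincide under this matching, so the categories are even isomorphic.
\<close>

section \<open>Categories and isomorphisms of categories\<close>

lemma Hom_Arr: "f \<in> Hom C X Y \<Longrightarrow> f \<in> Arr C"
  and Hom_Dom: "f \<in> Hom C X Y \<Longrightarrow> Dom C f = X"
  and Hom_Cod: "f \<in> Hom C X Y \<Longrightarrow> Cod C f = Y"
  by (simp_all add: Hom_def)

context category
begin

lemma Hom_Obj_source: "f \<in> Hom C X Y \<Longrightarrow> X \<in> Obj C"
  using Dom_Obj by (auto simp: Hom_def)

lemma Hom_Obj_target: "f \<in> Hom C X Y \<Longrightarrow> Y \<in> Obj C"
  using Cod_Obj by (auto simp: Hom_def)

lemma iso_ident:
  assumes "X \<in> Obj C"
  shows "iso_arrow C (ident C X)"
proof -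
  have "inverse_arrows C (ident C X) (ident C X)"
    using ident_Hom[OF assms] Comp_ident_right[OF ident_Hom[OF assms]]
    by (simp add: inverse_arrows_def Hom_Arr Hom_Dom Hom_Cod)
  then show ?thesis
    by (auto simp: iso_arrow_def)
qed

lemma covariant_identity_functor: "covariant_functor C C identity_functor"
  by unfold_locales (simp_all add: identity_functor_def)

end

lemma covariant_comp_functor:
  assumes "covariant_functor C D F" and "covariant_functor D E G"
  shows "covariant_functor C E (comp_functor G F)"
proof -
  interpret F: covariant_functor C D F by fact
  interpret G: covariant_functor D E G by fact
  show ?thesis
  proof
    fix f g X Y Z
    assume "f \<in> Hom C X Y" and "g \<in> Hom C Y Z"
    then show "amap (comp_functor G F) (g \<cdot>\<^bsub>C\<^esub> f)
        = amap (comp_functor G F) g \<cdot>\<^bsub>E\<^esub> amap (comp_functor G F) f"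
      by (simp add: comp_functor_def F.amap_Comp G.amap_Comp[OF F.amap_Hom F.amap_Hom])
  qed (simp_all add: comp_functor_def F.omap_Obj F.amap_Hom F.amap_ident
      G.omap_Obj G.amap_Hom G.amap_ident)
qed

text \<open>With identities as components, naturality reduces to the two unit laws of
  \<open>D\<close>. Agreement is required on \<open>Obj C\<close> and \<open>Arr C\<close> alone:
  functor data are total functions, so composites such as \<open>comp_functor G F\<close> need not
  equal \<open>identity_functor\<close> outside the carriers.\<close>

lemma natural_isomorphism_ident:
  assumes "covariant_functor C D F" and "covariant_functor C D G"
    and omap: "\<And>X. X \<in> Obj C \<Longrightarrow> omap F X = omap G X"
    and amap: "\<And>f. f \<in> Arr C \<Longrightarrow> amap F f = amap G f"
  shows "natural_isomorphism C D F G (\<lambda>X. ident D (omap G X))"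
proof -
  interpret F: covariant_functor C D F by fact
  interpret G: covariant_functor C D G by fact
  show ?thesis
  proof
    fix X
    assume X: "X \<in> Obj C"
    show "ident D (omap G X) \<in> Hom D (omap F X) (omap G X)"
      using X by (simp add: omap G.omap_Obj F.D.ident_Hom)
    show "iso_arrow D (ident D (omap G X))"
      using X by (simp add: G.omap_Obj F.D.iso_ident)
  next
    fix f X Y
    assume f: "f \<in> Hom C X Y"
    then show "amap G f \<cdot>\<^bsub>D\<^esub> ident D (omap G X) = ident D (omap G Y) \<cdot>\<^bsub>D\<^esub> amap F f"
      using G.amap_Hom[OF f] amap[OF Hom_Arr[OF f]]
      by (simp add: F.D.Comp_ident_left F.D.Comp_ident_right)
  qed
qed

text \<open>An isomorphism of categories is an equivalence whose unit and counit consist of identity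
  arrows.\<close>

lemma equivalent_categories_inverse_functors:
  assumes F: "covariant_functor C D F" and G: "covariant_functor D C G"
    and "\<And>X. X \<in> Obj C \<Longrightarrow> omap G (omap F X) = X"
    and "\<And>f. f \<in> Arr C \<Longrightarrow> amap G (amap F f) = f"
    and "\<And>Y. Y \<in> Obj D \<Longrightarrow> omap F (omap G Y) = Y"
    and "\<And>g. g \<in> Arr D \<Longrightarrow> amap F (amap G g) = g"
  shows "equivalent_categories C D"
proof -
  interpret F: covariant_functor C D F by fact
  have "\<exists>\<eta>. natural_isomorphism C C identity_functor (comp_functor G F) \<eta>"
    by (rule exI, rule natural_isomorphism_ident[OF F.C.covariant_identity_functor
          covariant_comp_functor[OF F G]])
      (simp_all add: identity_functor_def comp_functor_def assms)
  moreover have "\<exists>\<epsilon>. natural_isomorphism D D (comp_functor F G) identity_functor \<epsilon>"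
    by (rule exI, rule natural_isomorphism_ident[OF covariant_comp_functor[OF G F]
          F.D.covariant_identity_functor])
      (simp_all add: identity_functor_def comp_functor_def assms)
  ultimately show ?thesis
    unfolding equivalent_categories_def
    using F G F.C.category_axioms F.D.category_axioms by blast
qed

section \<open>Preadditive and monoidal categories\<close>

context preadditive_category
begin

text \<open>Trades the inverse hidden in \<open>\<ominus>\<close>, taken in the hom group of the
  subtrahend, for an equation about \<open>\<oplus>\<close>. The compatibility laws for differences
  can then be read off from those for sums.\<close>

lemma Diff_eq_iff:
  assumes f: "f \<in> Hom C X Y" and g: "g \<in> Hom C X Y" and h: "h \<in> Hom C X Y"
  shows "f \<ominus> g = h \<longleftrightarrow> f = h \<oplus> g"
proof -
  interpret G: comm_group "hom_group C X Y"
    using f hom_comm_group Hom_Obj_source Hom_Obj_target by blast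
  have "f = h \<otimes>\<^bsub>hom_group C X Y\<^esub> g
      \<longleftrightarrow> f \<otimes>\<^bsub>hom_group C X Y\<^esub> inv\<^bsub>hom_group C X Y\<^esub> g = h"
    using f g h G.inv_solve_right[of h f g] by (auto simp: hom_group_def)
  then show ?thesis
    using g by (auto simp: Diff_def Hom_Dom Hom_Cod hom_group_def)
qed

lemma Diff_Hom:
  assumes f: "f \<in> Hom C X Y" and g: "g \<in> Hom C X Y"
  shows "f \<ominus> g \<in> Hom C X Y"
proof -
  interpret G: comm_group "hom_group C X Y"
    using f hom_comm_group Hom_Obj_source Hom_Obj_target by blast
  have "f \<otimes>\<^bsub>hom_group C X Y\<^esub> inv\<^bsub>hom_group C X Y\<^esub> g \<in> carrier (hom_group C X Y)"
    using f g by (intro G.m_closed G.inv_closed) (simp_all add: hom_group_def)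
  then show ?thesis
    using g by (simp add: Diff_def Hom_Dom Hom_Cod hom_group_def)
qed

text \<open>Bridges the two shapes of the identities: the module axiom says that a difference
  vanishes, whereas preservation of brackets is an equality.\<close>

lemma Diff_eq_zero_iff:
  assumes f: "f \<in> Hom C X Y" and g: "g \<in> Hom C X Y"
  shows "f \<ominus> g = zero_arrow C X Y \<longleftrightarrow> f = g"
proof -
  interpret G: comm_group "hom_group C X Y"
    using f hom_comm_group Hom_Obj_source Hom_Obj_target by blast
  have "zero_arrow C X Y \<in> Hom C X Y" and "zero_arrow C X Y \<oplus> g = g"
    using G.one_closed G.l_one[of g] g by (simp_all add: hom_group_def)
  then show ?thesis
    using Diff_eq_iff[OF f g] by simp
qed

lemma Diff_Add_cancel:
  assumes "f \<in> Hom C X Y" and "g \<in> Hom C X Y"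
  shows "(f \<ominus> g) \<oplus> g = f"
  using Diff_eq_iff[OF assms Diff_Hom[OF assms]] by simp

text \<open>Distribute composition over \<open>(g \<ominus> g') \<oplus> g' = g\<close> and solve
  for the first summand. \<open>Comp_Diff_right\<close> and \<open>tensor_Diff_left\<close> follow
  the same pattern.\<close>

lemma Comp_Diff_left:
  assumes f: "f \<in> Hom C X Y" and g: "g \<in> Hom C Y Z" and g': "g' \<in> Hom C Y Z"
  shows "(g \<ominus> g') \<cdot> f = g \<cdot> f \<ominus> g' \<cdot> f"
proof -
  have "g \<cdot> f = (g \<ominus> g') \<cdot> f \<oplus> g' \<cdot> f"
    using Comp_Add_left[OF f Diff_Hom[OF g g'] g'] by (simp add: Diff_Add_cancel[OF g g'])
  then show ?thesis
    using Diff_eq_iff[OF Comp_Hom[OF f g] Comp_Hom[OF f g'] Comp_Hom[OF f Diff_Hom[OF g g']]]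
    by simp
qed

lemma Comp_Diff_right:
  assumes f: "f \<in> Hom C X Y" and f': "f' \<in> Hom C X Y" and g: "g \<in> Hom C Y Z"
  shows "g \<cdot> (f \<ominus> f') = g \<cdot> f \<ominus> g \<cdot> f'"
proof -
  have "g \<cdot> f = g \<cdot> (f \<ominus> f') \<oplus> g \<cdot> f'"
    using Comp_Add_right[OF Diff_Hom[OF f f'] f' g] by (simp add: Diff_Add_cancel[OF f f'])
  then show ?thesis
    using Diff_eq_iff[OF Comp_Hom[OF f g] Comp_Hom[OF f' g] Comp_Hom[OF Diff_Hom[OF f f'] g]]
    by simp
qed

end

lemma (in additive_symmetric_closed_monoidal_category) tensor_Diff_left:
  assumes f: "f \<in> Hom C X X'" and f': "f' \<in> Hom C X X'" and g: "g \<in> Hom C Y Y'"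
  shows "(f \<ominus> f') \<otimes>\<^sub>a g = f \<otimes>\<^sub>a g \<ominus> f' \<otimes>\<^sub>a g"
proof -
  have "f \<otimes>\<^sub>a g = (f \<ominus> f') \<otimes>\<^sub>a g \<oplus> f' \<otimes>\<^sub>a g"
    using tensor_Add_left[OF Diff_Hom[OF f f'] f' g] by (simp add: Diff_Add_cancel[OF f f'])
  then show ?thesis
    using Diff_eq_iff[OF tensor_Hom[OF f g] tensor_Hom[OF f' g]
        tensor_Hom[OF Diff_Hom[OF f f'] g]]
    by simp
qed

context monoidal_category
begin

lemma tensor_Comp_ident:
  assumes "f \<in> Hom C X Y" and "g \<in> Hom C Y Z" and "W \<in> Obj C"
  shows "(g \<cdot> f) \<otimes>\<^sub>a ident C W = (g \<otimes>\<^sub>a ident C W) \<cdot> (f \<otimes>\<^sub>a ident C W)"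
  using tensor_Comp[OF assms(1,2) ident_Hom[OF assms(3)] ident_Hom[OF assms(3)]]
  by (simp add: Comp_ident_left[OF ident_Hom[OF assms(3)]])

lemma ident_tensor_Comp:
  assumes "f \<in> Hom C X Y" and "g \<in> Hom C Y Z" and "W \<in> Obj C"
  shows "ident C W \<otimes>\<^sub>a (g \<cdot> f) = (ident C W \<otimes>\<^sub>a g) \<cdot> (ident C W \<otimes>\<^sub>a f)"
  using tensor_Comp[OF ident_Hom[OF assms(3)] ident_Hom[OF assms(3)] assms(1,2)]
  by (simp add: Comp_ident_left[OF ident_Hom[OF assms(3)]])

end

section \<open>Transposition along the closed structure\<close>

text \<open>The inverse of \<open>adj\<close>, written in universal-arrow form. In this form it is
  literally the composite occurring in \<open>lie_representation_morphism\<close>, and for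
  \<open>\<phi>\<close> from \<open>L\<close> to \<open>H(X, X)\<close> it is the action of
  \<open>L\<close> on \<open>X\<close>.\<close>

definition transpose ::
  "('o, 'm, 'z) closed_monoidal_category_scheme \<Rightarrow> 'o \<Rightarrow> 'o \<Rightarrow> 'm \<Rightarrow> 'm" where
  "transpose C X Z \<phi> = counit C X Z \<cdot>\<^bsub>C\<^esub> (\<phi> \<otimes>\<^sub>a\<^bsub>C\<^esub> ident C X)"

context symmetric_closed_monoidal_category
begin

lemma ihom_Obj: "X \<in> Obj C \<Longrightarrow> Z \<in> Obj C \<Longrightarrow> ihom_obj C X Z \<in> Obj C"
  using covariant_functor.omap_Obj[OF ihom_functor] by simp

lemma adj_Hom:
  assumes "X \<in> Obj C" and "Y \<in> Obj C" and "f \<in> Hom C (Y \<otimes>\<^sub>o X) Z"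
  shows "adj C X Y Z f \<in> Hom C Y (ihom_obj C X Z)"
  using adj_bij[OF assms(1,2) Hom_Obj_target[OF assms(3)]] assms(3) by (auto simp: bij_betw_def)

text \<open>\<open>counit\<close> is an \<open>inv_into\<close> preimage of an identity, so both
  claims rest on surjectivity of \<open>adj\<close>, which puts that identity in the image.\<close>

lemma counit_Hom_and_adj:
  assumes "X \<in> Obj C" and "Z \<in> Obj C"
  shows "counit C X Z \<in> Hom C (ihom_obj C X Z \<otimes>\<^sub>o X) Z"
    and "adj C X (ihom_obj C X Z) Z (counit C X Z) = ident C (ihom_obj C X Z)"
proof -
  have "ident C (ihom_obj C X Z) \<in> adj C X (ihom_obj C X Z) Z ` Hom C (ihom_obj C X Z \<otimes>\<^sub>o X) Z"
    using adj_bij[OF assms(1) ihom_Obj[OF assms] assms(2)] ident_Hom[OF ihom_Obj[OF assms]]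
    by (simp add: bij_betw_def)
  then show "counit C X Z \<in> Hom C (ihom_obj C X Z \<otimes>\<^sub>o X) Z"
    and "adj C X (ihom_obj C X Z) Z (counit C X Z) = ident C (ihom_obj C X Z)"
    unfolding counit_def by (rule inv_into_into, rule f_inv_into_f)
qed

lemmas counit_Hom = counit_Hom_and_adj(1)
lemmas adj_counit = counit_Hom_and_adj(2)

lemma transpose_Hom:
  assumes "X \<in> Obj C" and "Z \<in> Obj C" and "\<phi> \<in> Hom C Y (ihom_obj C X Z)"
  shows "transpose C X Z \<phi> \<in> Hom C (Y \<otimes>\<^sub>o X) Z"
  unfolding transpose_def
  using assms by (meson Comp_Hom tensor_Hom ident_Hom counit_Hom)

lemma adj_transpose:
  assumes X: "X \<in> Obj C" and Z: "Z \<in> Obj C" and \<phi>: "\<phi> \<in> Hom C Y (ihom_obj C X Z)"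
  shows "adj C X Y Z (transpose C X Z \<phi>) = \<phi>"
proof -
  \<comment> \<open>Naturality of \<open>adj\<close> at the counit, with \<open>\<phi>\<close> in
    the source variable. Since \<open>adj_natural\<close> treats both variables at once, the target
    variable is filled with an identity, which is removed afterwards.\<close>
  have "adj C X Y Z (ident C Z \<cdot> counit C X Z \<cdot> (\<phi> \<otimes>\<^sub>a ident C X))
      = ihom_arr C X (ident C Z) \<cdot> adj C X (ihom_obj C X Z) Z (counit C X Z) \<cdot> \<phi>"
    using adj_natural[OF X \<phi> ident_Hom[OF Z] counit_Hom[OF X Z]] .
  moreover have "ihom_arr C X (ident C Z) = ident C (ihom_obj C X Z)"
    using covariant_functor.amap_ident[OF ihom_functor[OF X] Z] by simp
  ultimately show ?thesis
    using Comp_ident_left[OF transpose_Hom[OF assms]] Comp_ident_left[OF \<phi>]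
    by (simp add: adj_counit[OF X Z] transpose_def)
qed

text \<open>By \<open>adj_transpose\<close>, both sides have the same image under
  \<open>adj\<close>, which is injective.\<close>

lemma transpose_adj:
  assumes X: "X \<in> Obj C" and Y: "Y \<in> Obj C" and f: "f \<in> Hom C (Y \<otimes>\<^sub>o X) Z"
  shows "transpose C X Z (adj C X Y Z f) = f"
proof -
  have Z: "Z \<in> Obj C"
    using f by (rule Hom_Obj_target)
  have "inj_on (adj C X Y Z) (Hom C (Y \<otimes>\<^sub>o X) Z)"
    using adj_bij[OF X Y Z] by (rule bij_betw_imp_inj_on)
  then show ?thesis
    using adj_transpose[OF X Z adj_Hom[OF X Y f]] transpose_Hom[OF X Z adj_Hom[OF X Y f]] f
    by (rule inj_onD)
qed

lemma transpose_eq_iff: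
  assumes "X \<in> Obj C" and "Z \<in> Obj C"
    and "\<phi> \<in> Hom C Y (ihom_obj C X Z)" and "\<psi> \<in> Hom C Y (ihom_obj C X Z)"
  shows "transpose C X Z \<phi> = transpose C X Z \<psi> \<longleftrightarrow> \<phi> = \<psi>"
  using adj_transpose assms by metis

lemma transpose_Comp:
  assumes X: "X \<in> Obj C" and Z: "Z \<in> Obj C"
    and g: "g \<in> Hom C W Y" and \<phi>: "\<phi> \<in> Hom C Y (ihom_obj C X Z)"
  shows "transpose C X Z (\<phi> \<cdot> g) = transpose C X Z \<phi> \<cdot> (g \<otimes>\<^sub>a ident C X)"
  unfolding transpose_def tensor_Comp_ident[OF g \<phi> X]
  by (rule Comp_assoc[OF tensor_Hom[OF g ident_Hom[OF X]] tensor_Hom[OF \<phi> ident_Hom[OF X]]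
        counit_Hom[OF X Z], symmetric])

end

text \<open>Additivity of the tensor product in its first variable enters here, followed by
  bilinearity of composition.\<close>

lemma (in additive_symmetric_closed_monoidal_category) transpose_Diff:
  assumes X: "X \<in> Obj C" and Z: "Z \<in> Obj C"
    and \<phi>: "\<phi> \<in> Hom C Y (ihom_obj C X Z)" and \<psi>: "\<psi> \<in> Hom C Y (ihom_obj C X Z)"
  shows "transpose C X Z (\<phi> \<ominus> \<psi>) = transpose C X Z \<phi> \<ominus> transpose C X Z \<psi>"
  unfolding transpose_def tensor_Diff_left[OF \<phi> \<psi> ident_Hom[OF X]]
  by (rule Comp_Diff_right[OF tensor_Hom[OF \<phi> ident_Hom[OF X]] tensor_Hom[OF \<psi> ident_Hom[OF X]]
        counit_Hom[OF X Z]])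

section \<open>Lie actions and representations\<close>

context symmetric_closed_monoidal_category
begin

text \<open>Stated for an arbitrary arrow \<open>\<rho>\<close>, so that it covers both an action of
  \<open>L\<close> on \<open>X\<close> and the evaluation of \<open>H(X, X)\<close> on
  \<open>X\<close>.\<close>

lemma iterated_action_Hom:
  assumes "L \<in> Obj C" and "X \<in> Obj C" and "\<rho> \<in> Hom C (L \<otimes>\<^sub>o X) X"
  shows "\<rho> \<cdot> (ident C L \<otimes>\<^sub>a \<rho>) \<cdot> assoc C L L X \<in> Hom C ((L \<otimes>\<^sub>o L) \<otimes>\<^sub>o X) X"
  using assms by (meson Comp_Hom tensor_Hom ident_Hom assoc_Hom)

lemma ihom_mult_Hom:
  assumes "X \<in> Obj C"
  shows "ihom_mult C X \<in> Hom C (ihom_obj C X X \<otimes>\<^sub>o ihom_obj C X X) (ihom_obj C X X)"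
  unfolding ihom_mult_def Let_def
  using assms by (intro adj_Hom tensor_Obj ihom_Obj iterated_action_Hom counit_Hom)

text \<open>The central computation: multiplying two endomorphisms and then evaluating amounts to
  evaluating twice. Naturality of the associator moves \<open>\<phi> \<otimes> \<phi>\<close> past
  the reassociation, and the interchange law then pairs each copy of \<open>\<phi>\<close> with one
  evaluation.\<close>

lemma transpose_ihom_mult:
  assumes X: "X \<in> Obj C" and \<phi>: "\<phi> \<in> Hom C L (ihom_obj C X X)"
  defines "\<rho> \<equiv> transpose C X X \<phi>"
  shows "transpose C X X (ihom_mult C X \<cdot> (\<phi> \<otimes>\<^sub>a \<phi>)) = \<rho> \<cdot> (ident C L \<otimes>\<^sub>a \<rho>) \<cdot> assoc C L L X"
proof -
  let ?E = "ihom_obj C X X" and ?e = "counit C X X" and ?X = "ident C X"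
  have E: "?E \<in> Obj C" and e: "?e \<in> Hom C (?E \<otimes>\<^sub>o X) X"
    using X by (simp_all add: ihom_Obj counit_Hom)
  have L: "L \<in> Obj C" using \<phi> by (rule Hom_Obj_source)
  have iX: "?X \<in> Hom C X X" and iL: "ident C L \<in> Hom C L L" and iE: "ident C ?E \<in> Hom C ?E ?E"
    using X L E by (simp_all add: ident_Hom)
  have \<rho>: "\<rho> \<in> Hom C (L \<otimes>\<^sub>o X) X"
    unfolding \<rho>_def by (rule transpose_Hom[OF X X \<phi>])
  have \<phi>X: "\<phi> \<otimes>\<^sub>a ?X \<in> Hom C (L \<otimes>\<^sub>o X) (?E \<otimes>\<^sub>o X)"
    by (rule tensor_Hom[OF \<phi> iX])
  note assoc_L = assoc_Hom[OF L L X] and assoc_E = assoc_Hom[OF E E X]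
  note \<phi>\<phi> = tensor_Hom[OF \<phi> \<phi>] and L\<rho> = tensor_Hom[OF iL \<rho>] and Ee = tensor_Hom[OF iE e]
  \<comment> \<open>\<open>ihom_mult\<close> is defined as \<open>adj\<close> of the iterated
    evaluation, so \<open>transpose_adj\<close> gives that evaluation back.\<close>
  have "transpose C X X (ihom_mult C X \<cdot> (\<phi> \<otimes>\<^sub>a \<phi>))
      = (?e \<cdot> (ident C ?E \<otimes>\<^sub>a ?e) \<cdot> assoc C ?E ?E X) \<cdot> ((\<phi> \<otimes>\<^sub>a \<phi>) \<otimes>\<^sub>a ?X)"
    unfolding transpose_Comp[OF X X \<phi>\<phi> ihom_mult_Hom[OF X]]
    using transpose_adj[OF X tensor_Obj[OF E E] iterated_action_Hom[OF E X e]]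
    by (simp add: ihom_mult_def Let_def)
  also have "\<dots> = ?e \<cdot> (ident C ?E \<otimes>\<^sub>a ?e) \<cdot> (assoc C ?E ?E X \<cdot> ((\<phi> \<otimes>\<^sub>a \<phi>) \<otimes>\<^sub>a ?X))"
    using Comp_assoc[OF tensor_Hom[OF \<phi>\<phi> iX] Comp_Hom[OF assoc_E Ee] e]
      Comp_assoc[OF tensor_Hom[OF \<phi>\<phi> iX] assoc_E Ee]
    by simp
  also have "assoc C ?E ?E X \<cdot> ((\<phi> \<otimes>\<^sub>a \<phi>) \<otimes>\<^sub>a ?X) = (\<phi> \<otimes>\<^sub>a (\<phi> \<otimes>\<^sub>a ?X)) \<cdot> assoc C L L X"
    by (rule assoc_natural[OF \<phi> \<phi> iX])
  also have "(ident C ?E \<otimes>\<^sub>a ?e) \<cdot> (\<phi> \<otimes>\<^sub>a (\<phi> \<otimes>\<^sub>a ?X)) \<cdot> assoc C L L X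
      = ((ident C ?E \<otimes>\<^sub>a ?e) \<cdot> (\<phi> \<otimes>\<^sub>a (\<phi> \<otimes>\<^sub>a ?X))) \<cdot> assoc C L L X"
    by (rule Comp_assoc[OF assoc_L tensor_Hom[OF \<phi> \<phi>X] Ee, symmetric])
  \<comment> \<open>Interchange: the inner evaluation absorbs the second copy of
    \<open>\<phi>\<close> and becomes \<open>\<rho>\<close>.\<close>
  also have "(ident C ?E \<otimes>\<^sub>a ?e) \<cdot> (\<phi> \<otimes>\<^sub>a (\<phi> \<otimes>\<^sub>a ?X)) = \<phi> \<otimes>\<^sub>a \<rho>"
    using tensor_Comp[OF \<phi> iE \<phi>X e] by (simp add: Comp_ident_left[OF \<phi>] \<rho>_def transpose_def)
  \<comment> \<open>Interchange in the other direction: \<open>\<rho>\<close> is applied first,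
    which leaves \<open>\<phi> \<otimes> X\<close> next to the outer evaluation, where the two form
    the outer \<open>\<rho>\<close>.\<close>
  also have "\<phi> \<otimes>\<^sub>a \<rho> = (\<phi> \<otimes>\<^sub>a ?X) \<cdot> (ident C L \<otimes>\<^sub>a \<rho>)"
    using tensor_Comp[OF iL \<phi> \<rho> iX] by (simp add: Comp_ident_left[OF \<rho>] Comp_ident_right[OF \<phi>])
  also have "?e \<cdot> ((\<phi> \<otimes>\<^sub>a ?X) \<cdot> (ident C L \<otimes>\<^sub>a \<rho>)) \<cdot> assoc C L L X
      = (?e \<cdot> (\<phi> \<otimes>\<^sub>a ?X)) \<cdot> (ident C L \<otimes>\<^sub>a \<rho>) \<cdot> assoc C L L X"
    using Comp_assoc[OF assoc_L L\<rho> \<phi>X] Comp_assoc[OF Comp_Hom[OF assoc_L L\<rho>] \<phi>X e]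
    by simp
  finally show ?thesis
    by (simp add: \<rho>_def transpose_def)
qed

text \<open>After unfolding \<open>transpose\<close>, the two equations on \<open>f\<close> differ
  only in the bracketing of the right-hand composite.\<close>

lemma lie_module_morphism_transpose_iff:
  assumes "L \<in> Obj C" and "X \<in> Obj C" and "Y \<in> Obj C"
    and "\<phi> \<in> Hom C L (ihom_obj C X X)" and "\<psi> \<in> Hom C L (ihom_obj C Y Y)"
  shows "lie_module_morphism C L (X, transpose C X X \<phi>) (Y, transpose C Y Y \<psi>) f
    \<longleftrightarrow> lie_representation_morphism C L (X, \<phi>) (Y, \<psi>) f"
proof -
  have "(counit C Y Y \<cdot> (\<psi> \<otimes>\<^sub>a ident C Y)) \<cdot> (ident C L \<otimes>\<^sub>a f)
      = counit C Y Y \<cdot> (\<psi> \<otimes>\<^sub>a ident C Y) \<cdot> (ident C L \<otimes>\<^sub>a f)" if "f \<in> Hom C X Y"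
    by (rule Comp_assoc[OF tensor_Hom[OF ident_Hom[OF assms(1)] that]
          tensor_Hom[OF assms(5) ident_Hom[OF assms(3)]] counit_Hom[OF assms(3,3)]])
  then show ?thesis
    by (auto simp: lie_module_morphism_def lie_representation_morphism_def transpose_def)
qed

lemma lie_module_morphism_ident:
  assumes "L \<in> Obj C" and "X \<in> Obj C" and "\<rho> \<in> Hom C (L \<otimes>\<^sub>o X) X"
  shows "lie_module_morphism C L (X, \<rho>) (X, \<rho>) (ident C X)"
  using assms
  by (simp add: lie_module_morphism_def ident_Hom tensor_ident Comp_ident_left Comp_ident_right)

text \<open>Pasting of the commuting squares for \<open>f\<close> and \<open>g\<close>. The actions
  are arbitrary arrows of the right type, so the lemma applies to transposes of representations as
  well as to modules.\<close>

lemma lie_module_morphism_Comp: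
  assumes L: "L \<in> Obj C" and \<rho>: "\<rho> \<in> Hom C (L \<otimes>\<^sub>o X) X" and \<sigma>: "\<sigma> \<in> Hom C (L \<otimes>\<^sub>o Y) Y"
    and \<tau>: "\<tau> \<in> Hom C (L \<otimes>\<^sub>o Z) Z"
    and mf: "lie_module_morphism C L (X, \<rho>) (Y, \<sigma>) f"
    and mg: "lie_module_morphism C L (Y, \<sigma>) (Z, \<tau>) g"
  shows "lie_module_morphism C L (X, \<rho>) (Z, \<tau>) (g \<cdot> f)"
proof -
  have f: "f \<in> Hom C X Y" and g: "g \<in> Hom C Y Z"
    and eq_f: "f \<cdot> \<rho> = \<sigma> \<cdot> (ident C L \<otimes>\<^sub>a f)" and eq_g: "g \<cdot> \<sigma> = \<tau> \<cdot> (ident C L \<otimes>\<^sub>a g)"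
    using mf mg by (simp_all add: lie_module_morphism_def)
  have Lf: "ident C L \<otimes>\<^sub>a f \<in> Hom C (L \<otimes>\<^sub>o X) (L \<otimes>\<^sub>o Y)"
    and Lg: "ident C L \<otimes>\<^sub>a g \<in> Hom C (L \<otimes>\<^sub>o Y) (L \<otimes>\<^sub>o Z)"
    using f g by (simp_all add: L ident_Hom tensor_Hom)
  have "(g \<cdot> f) \<cdot> \<rho> = (g \<cdot> \<sigma>) \<cdot> (ident C L \<otimes>\<^sub>a f)"
    by (simp add: Comp_assoc[OF \<rho> f g] Comp_assoc[OF Lf \<sigma> g] eq_f)
  also have "\<dots> = \<tau> \<cdot> (ident C L \<otimes>\<^sub>a (g \<cdot> f))"
    by (simp add: eq_g Comp_assoc[OF Lf Lg \<tau>] ident_tensor_Comp[OF f g L])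
  finally show ?thesis
    using Comp_Hom[OF f g] by (simp add: lie_module_morphism_def)
qed

end

context additive_symmetric_closed_monoidal_category
begin

text \<open>Preservation of brackets is an equation between arrows from \<open>L \<otimes> L\<close>
  to \<open>H(X, X)\<close>. Its transpose, an equation between arrows from
  \<open>(L \<otimes> L) \<otimes> X\<close> to \<open>X\<close>, is the module axiom with one term
  moved across.\<close>

lemma lie_module_transpose_iff:
  assumes L: "L \<in> Obj C" and X: "X \<in> Obj C" and \<Lambda>: "\<Lambda> \<in> Hom C (L \<otimes>\<^sub>o L) L"
    and \<phi>: "\<phi> \<in> Hom C L (ihom_obj C X X)"
  shows "lie_module C L \<Lambda> (X, transpose C X X \<phi>) \<longleftrightarrow> lie_representation C L \<Lambda> (X, \<phi>)"
proof -
  let ?E = "ihom_obj C X X" and ?m = "ihom_mult C X" and ?\<rho> = "transpose C X X \<phi>"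
  let ?a = "?\<rho> \<cdot> (ident C L \<otimes>\<^sub>a ?\<rho>) \<cdot> assoc C L L X"
  let ?c = "symmetry C L L" and ?cX = "symmetry C L L \<otimes>\<^sub>a ident C X"
  have E: "?E \<in> Obj C"
    using X by (simp add: ihom_Obj)
  have \<rho>: "?\<rho> \<in> Hom C (L \<otimes>\<^sub>o X) X"
    by (rule transpose_Hom[OF X X \<phi>])
  have c: "?c \<in> Hom C (L \<otimes>\<^sub>o L) (L \<otimes>\<^sub>o L)" and cE: "symmetry C ?E ?E \<in> Hom C (?E \<otimes>\<^sub>o ?E) (?E \<otimes>\<^sub>o ?E)"
    using L E by (simp_all add: sym_Hom)
  have cX: "?cX \<in> Hom C ((L \<otimes>\<^sub>o L) \<otimes>\<^sub>o X) ((L \<otimes>\<^sub>o L) \<otimes>\<^sub>o X)"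
    by (rule tensor_Hom[OF c ident_Hom[OF X]])
  have m: "?m \<in> Hom C (?E \<otimes>\<^sub>o ?E) ?E"
    by (rule ihom_mult_Hom[OF X])
  have \<phi>\<phi>: "\<phi> \<otimes>\<^sub>a \<phi> \<in> Hom C (L \<otimes>\<^sub>o L) (?E \<otimes>\<^sub>o ?E)"
    by (rule tensor_Hom[OF \<phi> \<phi>])
  have m\<phi>: "?m \<cdot> (\<phi> \<otimes>\<^sub>a \<phi>) \<in> Hom C (L \<otimes>\<^sub>o L) ?E"
    by (rule Comp_Hom[OF \<phi>\<phi> m])
  have m\<phi>c: "(?m \<cdot> (\<phi> \<otimes>\<^sub>a \<phi>)) \<cdot> ?c \<in> Hom C (L \<otimes>\<^sub>o L) ?E"
    by (rule Comp_Hom[OF c m\<phi>])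
  have \<phi>\<Lambda>: "\<phi> \<cdot> \<Lambda> \<in> Hom C (L \<otimes>\<^sub>o L) ?E"
    by (rule Comp_Hom[OF \<Lambda> \<phi>])
  have "ihom_bracket C X \<cdot> (\<phi> \<otimes>\<^sub>a \<phi>)
      = ?m \<cdot> (\<phi> \<otimes>\<^sub>a \<phi>) \<ominus> (?m \<cdot> symmetry C ?E ?E) \<cdot> (\<phi> \<otimes>\<^sub>a \<phi>)"
    unfolding ihom_bracket_def by (rule Comp_Diff_left[OF \<phi>\<phi> m Comp_Hom[OF cE m]])
  \<comment> \<open>Naturality of the symmetry moves the swap from the two copies of
    \<open>H(X, X)\<close> to the two copies of \<open>L\<close>.\<close>
  also have "(?m \<cdot> symmetry C ?E ?E) \<cdot> (\<phi> \<otimes>\<^sub>a \<phi>) = (?m \<cdot> (\<phi> \<otimes>\<^sub>a \<phi>)) \<cdot> ?c"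
    by (simp add: Comp_assoc[OF \<phi>\<phi> cE m] Comp_assoc[OF c \<phi>\<phi> m] sym_natural[OF \<phi> \<phi>])
  finally have bracket: "ihom_bracket C X \<cdot> (\<phi> \<otimes>\<^sub>a \<phi>)
      = ?m \<cdot> (\<phi> \<otimes>\<^sub>a \<phi>) \<ominus> (?m \<cdot> (\<phi> \<otimes>\<^sub>a \<phi>)) \<cdot> ?c" .
  \<comment> \<open>Transposition is injective, so brackets may be compared after
    transposing.\<close>
  have "lie_representation C L \<Lambda> (X, \<phi>)
      \<longleftrightarrow> transpose C X X (ihom_bracket C X \<cdot> (\<phi> \<otimes>\<^sub>a \<phi>)) = transpose C X X (\<phi> \<cdot> \<Lambda>)"
    using X \<phi> transpose_eq_iff[OF X X Diff_Hom[OF m\<phi> m\<phi>c] \<phi>\<Lambda>]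
    by (simp add: lie_representation_def lie_morphism_def bracket)
  also have "\<dots> \<longleftrightarrow> ?a \<ominus> ?a \<cdot> ?cX = ?\<rho> \<cdot> (\<Lambda> \<otimes>\<^sub>a ident C X)"
    by (simp add: bracket transpose_Diff[OF X X m\<phi> m\<phi>c] transpose_Comp[OF X X c m\<phi>]
        transpose_Comp[OF X X \<Lambda> \<phi>] transpose_ihom_mult[OF X \<phi>])
  also have "\<dots> \<longleftrightarrow> ?a \<ominus> ?a \<cdot> ?cX \<ominus> ?\<rho> \<cdot> (\<Lambda> \<otimes>\<^sub>a ident C X)
      = zero_arrow C ((L \<otimes>\<^sub>o L) \<otimes>\<^sub>o X) X"
    using iterated_action_Hom[OF L X \<rho>]
    by (intro Diff_eq_zero_iff[symmetric] Diff_Hom Comp_Hom[OF cX]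
        Comp_Hom[OF tensor_Hom[OF \<Lambda> ident_Hom[OF X]] \<rho>])
  \<comment> \<open>Rebracketing to the fully right-nested form in which \<open>lie_module\<close>
    states its second term.\<close>
  also have "?a \<cdot> ?cX = ?\<rho> \<cdot> (ident C L \<otimes>\<^sub>a ?\<rho>) \<cdot> assoc C L L X \<cdot> ?cX"
    using Comp_assoc[OF cX Comp_Hom[OF assoc_Hom[OF L L X] tensor_Hom[OF ident_Hom[OF L] \<rho>]] \<rho>]
      Comp_assoc[OF cX assoc_Hom[OF L L X] tensor_Hom[OF ident_Hom[OF L] \<rho>]]
    by simp
  finally show ?thesis
    using X \<rho> by (simp add: lie_module_def)
qed

section \<open>The categories of Lie modules and of representations\<close>

lemma lie_module_HomD:
  assumes "lie_module C L \<Lambda> (X, \<rho>)"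
  shows "X \<in> Obj C" and "\<rho> \<in> Hom C (L \<otimes>\<^sub>o X) X"
  using assms by (simp_all add: lie_module_def)

lemma lie_representation_HomD:
  assumes "lie_representation C L \<Lambda> (X, \<phi>)"
  shows "X \<in> Obj C" and "\<phi> \<in> Hom C L (ihom_obj C X X)"
  using assms by (simp_all add: lie_representation_def lie_morphism_def)

lemma Hom_LieMod:
  "(M, f, N) \<in> Hom (LieMod C L \<Lambda>) M' N' \<longleftrightarrow> M = M' \<and> N = N' \<and>
     lie_module C L \<Lambda> M \<and> lie_module C L \<Lambda> N \<and> lie_module_morphism C L M N f"
  by (auto simp: Hom_def LieMod_def)

lemma Hom_Rep:
  "(R, f, S) \<in> Hom (Rep C L \<Lambda>) R' S' \<longleftrightarrow> R = R' \<and> S = S' \<and>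
     lie_representation C L \<Lambda> R \<and> lie_representation C L \<Lambda> S \<and>
     lie_representation_morphism C L R S f"
  by (auto simp: Hom_def Rep_def)

lemma Obj_LieMod: "Obj (LieMod C L \<Lambda>) = {M. lie_module C L \<Lambda> M}"
  by (simp add: LieMod_def)

lemma Obj_Rep: "Obj (Rep C L \<Lambda>) = {R. lie_representation C L \<Lambda> R}"
  by (simp add: Rep_def)

text \<open>Exposes the underlying arrow of \<open>C\<close>, so that the unit and associativity
  laws are inherited from \<open>C\<close>; \<open>Hom_RepE\<close> does the same for
  representations.\<close>

lemma Hom_LieModE:
  assumes "f \<in> Hom (LieMod C L \<Lambda>) M N"
  obtains f' where "f = (M, f', N)" and "f' \<in> Hom C (fst M) (fst N)"
  using assms by (cases f; cases M; cases N) (auto simp: Hom_LieMod lie_module_morphism_def)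

lemma Comp_LieMod: "(N', g, P) \<cdot>\<^bsub>LieMod C L \<Lambda>\<^esub> (M, f, N) = (M, g \<cdot> f, P)"
  by (simp add: LieMod_def)

lemma ident_LieMod: "ident (LieMod C L \<Lambda>) M = (M, ident C (fst M), M)"
  by (simp add: LieMod_def)

lemma Hom_RepE:
  assumes "f \<in> Hom (Rep C L \<Lambda>) M N"
  obtains f' where "f = (M, f', N)" and "f' \<in> Hom C (fst M) (fst N)"
  using assms by (cases f; cases M; cases N) (auto simp: Hom_Rep lie_representation_morphism_def)

lemma Comp_Rep: "(N', g, P) \<cdot>\<^bsub>Rep C L \<Lambda>\<^esub> (M, f, N) = (M, g \<cdot> f, P)"
  by (simp add: Rep_def)

lemma ident_Rep: "ident (Rep C L \<Lambda>) M = (M, ident C (fst M), M)"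
  by (simp add: Rep_def)

lemma category_LieMod:
  assumes L: "L \<in> Obj C"
  shows "category (LieMod C L \<Lambda>)" (is "category ?M")
proof
  fix f
  assume "f \<in> Arr ?M"
  then show "Dom ?M f \<in> Obj ?M" and "Cod ?M f \<in> Obj ?M"
    by (auto simp: LieMod_def)
next
  fix A
  assume "A \<in> Obj ?M"
  then have A: "lie_module C L \<Lambda> A"
    by (simp add: Obj_LieMod)
  then have "lie_module_morphism C L A A (ident C (fst A))"
    using lie_module_morphism_ident[OF L] lie_module_HomD by (cases A) fastforce
  then have "(A, ident C (fst A), A) \<in> Hom ?M A A"
    using A by (simp add: Hom_LieMod)
  then show "ident ?M A \<in> Hom ?M A A"
    by (simp add: ident_LieMod)
next
  fix f g A B D
  assume "f \<in> Hom ?M A B" and "g \<in> Hom ?M B D"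
  then show "g \<cdot>\<^bsub>?M\<^esub> f \<in> Hom ?M A D"
    using lie_module_morphism_Comp[OF L] lie_module_HomD(2)
    by (cases f; cases g; cases A; cases B; cases D)
      (clarsimp simp: Hom_LieMod Comp_LieMod; blast)
next
  fix f A B
  assume "f \<in> Hom ?M A B"
  then show "f \<cdot>\<^bsub>?M\<^esub> ident ?M A = f" and "ident ?M B \<cdot>\<^bsub>?M\<^esub> f = f"
    by (auto elim!: Hom_LieModE simp: ident_LieMod Comp_LieMod Comp_ident_left Comp_ident_right)
next
  fix f g h A B D E
  assume "f \<in> Hom ?M A B" and "g \<in> Hom ?M B D" and "h \<in> Hom ?M D E"
  then show "(h \<cdot>\<^bsub>?M\<^esub> g) \<cdot>\<^bsub>?M\<^esub> f = h \<cdot>\<^bsub>?M\<^esub> (g \<cdot>\<^bsub>?M\<^esub> f)"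
    by (auto elim!: Hom_LieModE simp: Comp_LieMod Comp_assoc)
qed

text \<open>Oriented to rewrite morphisms of representations into morphisms of modules, through
  which \<open>category_Rep\<close> obtains identities and composites.\<close>

lemma lie_module_morphism_iff_representation:
  assumes "L \<in> Obj C"
    and "lie_representation C L \<Lambda> (X, \<phi>)" and "lie_representation C L \<Lambda> (Y, \<psi>)"
  shows "lie_representation_morphism C L (X, \<phi>) (Y, \<psi>) f
    \<longleftrightarrow> lie_module_morphism C L (X, transpose C X X \<phi>) (Y, transpose C Y Y \<psi>) f"
  using lie_module_morphism_transpose_iff lie_representation_HomD assms by blast

lemma category_Rep:
  assumes L: "L \<in> Obj C"
  shows "category (Rep C L \<Lambda>)" (is "category ?R")
proof
  fix f
  assume "f \<in> Arr ?R"
  then show "Dom ?R f \<in> Obj ?R" and "Cod ?R f \<in> Obj ?R"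
    by (auto simp: Rep_def)
next
  fix A
  assume A: "A \<in> Obj ?R"
  obtain X \<phi> where A_eq: "A = (X, \<phi>)"
    by (cases A)
  have "lie_representation C L \<Lambda> (X, \<phi>)"
    using A by (simp add: A_eq Obj_Rep)
  then have "lie_representation_morphism C L A A (ident C X)"
    unfolding A_eq
    using lie_module_morphism_iff_representation[OF L] lie_module_morphism_ident[OF L]
      transpose_Hom lie_representation_HomD by metis
  then show "ident ?R A \<in> Hom ?R A A"
    using A by (simp add: A_eq ident_Rep Hom_Rep Obj_Rep)
next
  fix f g A B D
  assume f: "f \<in> Hom ?R A B" and g: "g \<in> Hom ?R B D"
  obtain f' g' where fg_eq: "f = (A, f', B)" "g = (B, g', D)"
    using f g by (auto elim!: Hom_RepE)
  obtain X \<phi> Y \<psi> Z \<chi> where ABD_eq: "A = (X, \<phi>)" "B = (Y, \<psi>)" "D = (Z, \<chi>)"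
    by (cases A, cases B, cases D)
  have reps: "lie_representation C L \<Lambda> (X, \<phi>)" "lie_representation C L \<Lambda> (Y, \<psi>)"
    "lie_representation C L \<Lambda> (Z, \<chi>)"
    and "lie_representation_morphism C L (X, \<phi>) (Y, \<psi>) f'"
    and "lie_representation_morphism C L (Y, \<psi>) (Z, \<chi>) g'"
    using f g by (simp_all add: fg_eq ABD_eq Hom_Rep)
  then have "lie_module_morphism C L (X, transpose C X X \<phi>) (Y, transpose C Y Y \<psi>) f'"
    and "lie_module_morphism C L (Y, transpose C Y Y \<psi>) (Z, transpose C Z Z \<chi>) g'"
    by (simp_all add: lie_module_morphism_iff_representation[OF L])
  \<comment> \<open>Rotating the premises by three brings the two morphism assumptions to the front,
    where the chained facts meet them; the types of the three actions remain as goals.\<close>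
  then have "lie_module_morphism C L (X, transpose C X X \<phi>) (Z, transpose C Z Z \<chi>) (g' \<cdot> f')"
    by (rule lie_module_morphism_Comp[OF L, rotated 3])
      (intro transpose_Hom reps[THEN lie_representation_HomD(1)]
        reps[THEN lie_representation_HomD(2)])+
  then have "lie_representation_morphism C L (X, \<phi>) (Z, \<chi>) (g' \<cdot> f')"
    by (simp add: lie_module_morphism_iff_representation[OF L reps(1,3)])
  moreover have "g \<cdot>\<^bsub>?R\<^esub> f = (A, g' \<cdot> f', D)"
    by (simp add: fg_eq Comp_Rep)
  ultimately show "g \<cdot>\<^bsub>?R\<^esub> f \<in> Hom ?R A D"
    using reps by (simp add: Hom_Rep ABD_eq)
next
  fix f A B
  assume "f \<in> Hom ?R A B"
  then show "f \<cdot>\<^bsub>?R\<^esub> ident ?R A = f" and "ident ?R B \<cdot>\<^bsub>?R\<^esub> f = f"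
    by (auto elim!: Hom_RepE simp: ident_Rep Comp_Rep Comp_ident_left Comp_ident_right)
next
  fix f g h A B D E
  assume "f \<in> Hom ?R A B" and "g \<in> Hom ?R B D" and "h \<in> Hom ?R D E"
  then show "(h \<cdot>\<^bsub>?R\<^esub> g) \<cdot>\<^bsub>?R\<^esub> f = h \<cdot>\<^bsub>?R\<^esub> (g \<cdot>\<^bsub>?R\<^esub> f)"
    by (auto elim!: Hom_RepE simp: Comp_Rep Comp_assoc)
qed

end

section \<open>The mutually inverse functors\<close>

definition module_of_representation ::
  "('o, 'm, 'z) closed_monoidal_category_scheme \<Rightarrow> 'o \<times> 'm \<Rightarrow> 'o \<times> 'm" where
  "module_of_representation C = (\<lambda>(X, \<phi>). (X, transpose C X X \<phi>))"

text \<open>\<open>adj\<close> is indexed by the source object, so \<open>L\<close> has to be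
  supplied here, whereas \<open>transpose\<close> does not mention it.\<close>

definition representation_of_module ::
  "('o, 'm, 'z) closed_monoidal_category_scheme \<Rightarrow> 'o \<Rightarrow> 'o \<times> 'm \<Rightarrow> 'o \<times> 'm" where
  "representation_of_module C L = (\<lambda>(X, \<rho>). (X, adj C X L X \<rho>))"

text \<open>The underlying arrow is kept and only its endpoints are relabelled by \<open>h\<close>;
  both functors of the equivalence have this form.\<close>

definition structure_functor ::
  "('p \<Rightarrow> 'q) \<Rightarrow> ('p, 'p \<times> 'm \<times> 'p, 'q, 'q \<times> 'm \<times> 'q) functor_data" where
  "structure_functor h = \<lparr>omap = h, amap = (\<lambda>(M, f, N). (h M, f, h N))\<rparr>"

context additive_symmetric_closed_monoidal_category
begin

lemma module_of_representation_of_module: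
  assumes "L \<in> Obj C" and "lie_module C L \<Lambda> M"
  shows "module_of_representation C (representation_of_module C L M) = M"
  using assms transpose_adj lie_module_HomD
  by (cases M) (auto simp: module_of_representation_def representation_of_module_def)

lemma representation_of_module_of_representation:
  assumes "lie_representation C L \<Lambda> R"
  shows "representation_of_module C L (module_of_representation C R) = R"
  using assms adj_transpose lie_representation_HomD
  by (cases R) (auto simp: module_of_representation_def representation_of_module_def)

lemma lie_module_of_representation:
  assumes "L \<in> Obj C" and "\<Lambda> \<in> Hom C (L \<otimes>\<^sub>o L) L" and "lie_representation C L \<Lambda> R"
  shows "lie_module C L \<Lambda> (module_of_representation C R)"
  using assms lie_module_transpose_iff lie_representation_HomD
  by (cases R) (auto simp: module_of_representation_def)

lemma lie_representation_of_module:
  assumes L: "L \<in> Obj C" and \<Lambda>: "\<Lambda> \<in> Hom C (L \<otimes>\<^sub>o L) L" and M: "lie_module C L \<Lambda> M"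
  shows "lie_representation C L \<Lambda> (representation_of_module C L M)"
proof (cases M)
  case (Pair X \<rho>)
  then have X: "X \<in> Obj C" and \<rho>: "\<rho> \<in> Hom C (L \<otimes>\<^sub>o X) X"
    using M lie_module_HomD by blast+
  show ?thesis
    \<comment> \<open>The equivalence is applied with \<open>adj\<close> of \<open>\<rho>\<close> as
      the representation; its transpose is \<open>\<rho>\<close> again.\<close>
    using M lie_module_transpose_iff[OF L X \<Lambda> adj_Hom[OF X L \<rho>]] transpose_adj[OF X L \<rho>]
    by (simp add: Pair representation_of_module_def)
qed

lemma lie_module_morphism_of_representation_iff:
  assumes "L \<in> Obj C" and "lie_representation C L \<Lambda> R" and "lie_representation C L \<Lambda> S"
  shows "lie_module_morphism C L (module_of_representation C R) (module_of_representation C S) f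
    \<longleftrightarrow> lie_representation_morphism C L R S f"
  using assms lie_module_morphism_iff_representation
  by (cases R; cases S) (simp add: module_of_representation_def)

lemma functor_module_of_representation:
  assumes "L \<in> Obj C" and "\<Lambda> \<in> Hom C (L \<otimes>\<^sub>o L) L"
  shows "covariant_functor (Rep C L \<Lambda>) (LieMod C L \<Lambda>)
    (structure_functor (module_of_representation C))"
proof (intro covariant_functor.intro category_Rep category_LieMod covariant_functor_axioms.intro)
  fix f A B
  assume "f \<in> Hom (Rep C L \<Lambda>) A B"
  then have "lie_representation C L \<Lambda> A" and "lie_representation C L \<Lambda> B"
    and "\<exists>f'. f = (A, f', B) \<and> lie_representation_morphism C L A B f'"
    by (cases f; simp add: Hom_Rep)+
  then show "amap (structure_functor (module_of_representation C)) f
      \<in> Hom (LieMod C L \<Lambda>) (omap (structure_functor (module_of_representation C)) A)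
          (omap (structure_functor (module_of_representation C)) B)"
    using lie_module_morphism_of_representation_iff[OF assms(1), of \<Lambda> A B]
    by (auto simp: structure_functor_def Hom_LieMod lie_module_of_representation[OF assms])
next
  \<comment> \<open>Identities are preserved because \<open>module_of_representation\<close> leaves
    the underlying object unchanged.\<close>
  fix A
  show "amap (structure_functor (module_of_representation C)) (ident (Rep C L \<Lambda>) A)
      = ident (LieMod C L \<Lambda>) (omap (structure_functor (module_of_representation C)) A)"
    by (cases A) (simp add: structure_functor_def module_of_representation_def Rep_def LieMod_def)
next
  \<comment> \<open>Both categories compose triples by the same formula on underlying arrows, so
    this is an identity between triples.\<close>
  fix f g A B D
  show "amap (structure_functor (module_of_representation C)) (g \<cdot>\<^bsub>Rep C L \<Lambda>\<^esub> f)
      = amap (structure_functor (module_of_representation C)) g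
        \<cdot>\<^bsub>LieMod C L \<Lambda>\<^esub> amap (structure_functor (module_of_representation C)) f"
    by (cases f; cases g) (simp add: structure_functor_def Rep_def LieMod_def)
qed (use assms in \<open>simp_all add: structure_functor_def Obj_Rep Obj_LieMod
      lie_module_of_representation\<close>)

lemma functor_representation_of_module:
  assumes "L \<in> Obj C" and "\<Lambda> \<in> Hom C (L \<otimes>\<^sub>o L) L"
  shows "covariant_functor (LieMod C L \<Lambda>) (Rep C L \<Lambda>)
    (structure_functor (representation_of_module C L))"
proof (intro covariant_functor.intro category_Rep category_LieMod covariant_functor_axioms.intro)
  fix f A B
  assume "f \<in> Hom (LieMod C L \<Lambda>) A B"
  then have "lie_module C L \<Lambda> A" and "lie_module C L \<Lambda> B"
    and "\<exists>f'. f = (A, f', B) \<and> lie_module_morphism C L A B f'"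
    by (cases f; simp add: Hom_LieMod)+
  \<comment> \<open>The comparison of morphisms is applied to the representations built from
    \<open>A\<close> and \<open>B\<close>; passing back to modules returns \<open>A\<close> and
    \<open>B\<close>, so it also serves in this direction.\<close>
  then show "amap (structure_functor (representation_of_module C L)) f
      \<in> Hom (Rep C L \<Lambda>) (omap (structure_functor (representation_of_module C L)) A)
          (omap (structure_functor (representation_of_module C L)) B)"
    using assms lie_module_morphism_of_representation_iff[OF assms(1)
        lie_representation_of_module[OF assms] lie_representation_of_module[OF assms], of A B]
    by (auto simp: structure_functor_def Hom_Rep lie_representation_of_module
        module_of_representation_of_module)
next
  fix A
  show "amap (structure_functor (representation_of_module C L)) (ident (LieMod C L \<Lambda>) A)
      = ident (Rep C L \<Lambda>) (omap (structure_functor (representation_of_module C L)) A)"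
    by (cases A) (simp add: structure_functor_def representation_of_module_def Rep_def LieMod_def)
next
  fix f g A B D
  show "amap (structure_functor (representation_of_module C L)) (g \<cdot>\<^bsub>LieMod C L \<Lambda>\<^esub> f)
      = amap (structure_functor (representation_of_module C L)) g
        \<cdot>\<^bsub>Rep C L \<Lambda>\<^esub> amap (structure_functor (representation_of_module C L)) f"
    by (cases f; cases g) (simp add: structure_functor_def Rep_def LieMod_def)
qed (use assms in \<open>simp_all add: structure_functor_def Obj_Rep Obj_LieMod
      lie_representation_of_module\<close>)

lemma equivalent_LieMod_Rep:
  assumes "L \<in> Obj C" and "\<Lambda> \<in> Hom C (L \<otimes>\<^sub>o L) L"
  shows "equivalent_categories (LieMod C L \<Lambda>) (Rep C L \<Lambda>)"
proof (rule equivalent_categories_inverse_functors[OF functor_representation_of_module[OF assms]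
      functor_module_of_representation[OF assms]])
  \<comment> \<open>An arrow is a triple whose middle entry both functors fix, so the round trip on
    arrows reduces to the round trip on the two endpoints.\<close>
  fix f
  assume "f \<in> Arr (LieMod C L \<Lambda>)"
  then show "amap (structure_functor (module_of_representation C))
      (amap (structure_functor (representation_of_module C L)) f) = f"
    using module_of_representation_of_module[OF assms(1)]
    by (auto simp: structure_functor_def LieMod_def)
next
  fix f
  assume "f \<in> Arr (Rep C L \<Lambda>)"
  then show "amap (structure_functor (representation_of_module C L))
      (amap (structure_functor (module_of_representation C)) f) = f"
    using representation_of_module_of_representation
    by (auto simp: structure_functor_def Rep_def)
qed (simp_all add: structure_functor_def Obj_Rep Obj_LieMod
      module_of_representation_of_module[OF assms(1)] representation_of_module_of_representation)

end

theorem proposition2p13: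
  fixes C :: "('o, 'm, 'z) closed_monoidal_category_scheme"
    and L :: 'o and \<Lambda> :: 'm
  assumes "additive_symmetric_closed_monoidal_category C"
    and "lie_algebra C L \<Lambda>"
  shows "equivalent_categories (LieMod C L \<Lambda>) (Rep C L \<Lambda>)"
  using additive_symmetric_closed_monoidal_category.equivalent_LieMod_Rep[OF assms(1)] assms(2)
  by (simp add: lie_algebra_def)

end
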